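(* Let $A$ be a Jacobi-Jordan (JJ) algebra over a field $k$ and $V$ a vector space viewed with the trivial JJ algebra structure $V_0=(V,\cdot_V=0)$. Then $$\mathbb{H}^2\bigl(A,V_0\bigr)=\bigsqcup_{\triangleright}\ \mathrm{H}^2_{\triangleright}(A,V_0),$$ where the coproduct on the right hand side is the disjoint union of sets over all possible JJ $A$-module structures $\triangleright$ on the vector space $V$.
   Context: $k$ is an arbitrary field. A JJ algebra is a $k$-vector space $A$ with a bilinear map $\cdot:A\times A\to A$ such that $a\cdot b=b\cdot a$ and $a\cdot(b\cdot c)+b\cdot(c\cdot a)+c\cdot(a\cdot b)=0$. A JJ $A$-module structure on $V$ is a bilinear map $\triangleright:A\times V\to V$ with $(a\cdot b)\triangleright x=-a\triangleright(b\triangleright x)-b\triangleright(a\triangleright x)$ for all $a,b\in A$, $x\in V$. $\mathcal{CS}_0(A,V_0)$ is the set of pairs $(\triangleright,\vartheta)$ of bilinear maps $\triangleright:A\times V\to V$, $\vartheta:A\times A\to V$ such that $A\times V$ with multiplication $(a,x)\bullet(b,y):=(a\cdot b,\ \vartheta(a,b)+a\triangleright y+b\triangleright x)$ is a JJ algebra. $(\triangleright,\vartheta)\approx_0(\triangleright',\vartheta')$ means that $\triangleright=\triangleright'$ and there is a linear map $r:A\to V$ with $$\vartheta(a,b)=\vartheta'(a,b)+a\triangleright r(b)+b\triangleright r(a)-r(a\cdot b)\quad\text{for all }a,b\in A.\qquad( * )$$ Then $\mathbb{H}^2(A,V_0):=\mathcal{CS}_0(A,V_0)/\approx_0$. For a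 fixed JJ $A$-module structure $\triangleright$ on $V$, $\mathrm{Z}^2_\triangleright(A,V_0)$ is the set of symmetric bilinear maps $\vartheta:A\times A\to V$ with $\vartheta(a,b\cdot c)+\vartheta(b,c\cdot a)+\vartheta(c,a\cdot b)+a\triangleright\vartheta(b,c)+b\triangleright\vartheta(c,a)+c\triangleright\vartheta(a,b)=0$ for all $a,b,c\in A$; $\vartheta\approx_0\vartheta'$ if there is a linear map $r:A\to V$ satisfying $( * )$; and $\mathrm{H}^2_\triangleright(A,V_0):=\mathrm{Z}^2_\triangleright(A,V_0)/\approx_0$. In the equality, the class of $\vartheta$ in the component indexed by $\triangleright$ is identified with the class of $(\triangleright,\vartheta)$. *)

theory Defs
  imports "HOL-Analysis.Product_Vector"
begin

text \<open>
  Vector spaces over an arbitrary field are given by a scalar multiplication on an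
  abelian group type, as in \<^locale>\<open>vector_space\<close>.
\<close>

definition bilinear_map ::
    "('k::field \<Rightarrow> 'a::ab_group_add \<Rightarrow> 'a) \<Rightarrow> ('k \<Rightarrow> 'b::ab_group_add \<Rightarrow> 'b) \<Rightarrow>
     ('k \<Rightarrow> 'c::ab_group_add \<Rightarrow> 'c) \<Rightarrow> ('a \<Rightarrow> 'b \<Rightarrow> 'c) \<Rightarrow> bool" where
  "bilinear_map s1 s2 s3 f \<longleftrightarrow>
     (\<forall>x. Vector_Spaces.linear s2 s3 (\<lambda>y. f x y)) \<and>
     (\<forall>y. Vector_Spaces.linear s1 s3 (\<lambda>x. f x y))"

locale jj_algebra = vector_space scale
  for scale :: "'k::field \<Rightarrow> 'a::ab_group_add \<Rightarrow> 'a" +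
  fixes mul :: "'a \<Rightarrow> 'a \<Rightarrow> 'a"
  assumes bilinear: "bilinear_map scale scale scale mul"
    and commute: "mul a b = mul b a"
    and jacobi: "mul a (mul b c) + mul b (mul c a) + mul c (mul a b) = 0"

text \<open>
  In the following, \<open>sA\<close> and \<open>mul\<close> are the scalar multiplication and the product of the
  JJ algebra \<open>A\<close>, \<open>sV\<close> is the scalar multiplication of \<open>V\<close>, and \<open>act\<close> is the map \<open>A \<times> V \<rightarrow> V\<close>.
  The product of \<open>V\<^sub>0\<close> is zero, so it does not appear.
\<close>

definition jj_module ::
    "('k::field \<Rightarrow> 'a::ab_group_add \<Rightarrow> 'a) \<Rightarrow> ('a \<Rightarrow> 'a \<Rightarrow> 'a) \<Rightarrow>
     ('k \<Rightarrow> 'v::ab_group_add \<Rightarrow> 'v) \<Rightarrow> ('a \<Rightarrow> 'v \<Rightarrow> 'v) \<Rightarrow> bool" where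
  "jj_module sA mul sV act \<longleftrightarrow>
     bilinear_map sA sV sV act \<and>
     (\<forall>a b x. act (mul a b) x = - act a (act b x) - act b (act a x))"

definition crossed_mul ::
    "('a \<Rightarrow> 'a \<Rightarrow> 'a) \<Rightarrow> ('a \<Rightarrow> 'v::ab_group_add \<Rightarrow> 'v) \<Rightarrow> ('a \<Rightarrow> 'a \<Rightarrow> 'v) \<Rightarrow>
     'a \<times> 'v \<Rightarrow> 'a \<times> 'v \<Rightarrow> 'a \<times> 'v" where
  "crossed_mul mul act \<theta> = (\<lambda>(a, x) (b, y). (mul a b, \<theta> a b + act a y + act b x))"

definition CS0 ::
    "('k::field \<Rightarrow> 'a::ab_group_add \<Rightarrow> 'a) \<Rightarrow> ('a \<Rightarrow> 'a \<Rightarrow> 'a) \<Rightarrow>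
     ('k \<Rightarrow> 'v::ab_group_add \<Rightarrow> 'v) \<Rightarrow> (('a \<Rightarrow> 'v \<Rightarrow> 'v) \<times> ('a \<Rightarrow> 'a \<Rightarrow> 'v)) set" where
  "CS0 sA mul sV =
     {(act, \<theta>). bilinear_map sA sV sV act \<and> bilinear_map sA sA sV \<theta> \<and>
        jj_algebra (module_prod.scale sA sV) (crossed_mul mul act \<theta>)}"

definition cohomologous ::
    "('k::field \<Rightarrow> 'a::ab_group_add \<Rightarrow> 'a) \<Rightarrow> ('a \<Rightarrow> 'a \<Rightarrow> 'a) \<Rightarrow>
     ('k \<Rightarrow> 'v::ab_group_add \<Rightarrow> 'v) \<Rightarrow> ('a \<Rightarrow> 'v \<Rightarrow> 'v) \<Rightarrow>
     ('a \<Rightarrow> 'a \<Rightarrow> 'v) \<Rightarrow> ('a \<Rightarrow> 'a \<Rightarrow> 'v) \<Rightarrow> bool" where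
  "cohomologous sA mul sV act \<theta> \<theta>' \<longleftrightarrow>
     (\<exists>r. Vector_Spaces.linear sA sV r \<and>
        (\<forall>a b. \<theta> a b = \<theta>' a b + act a (r b) + act b (r a) - r (mul a b)))"

definition CS0_rel ::
    "('k::field \<Rightarrow> 'a::ab_group_add \<Rightarrow> 'a) \<Rightarrow> ('a \<Rightarrow> 'a \<Rightarrow> 'a) \<Rightarrow>
     ('k \<Rightarrow> 'v::ab_group_add \<Rightarrow> 'v) \<Rightarrow> (('a \<Rightarrow> 'v \<Rightarrow> 'v) \<times> ('a \<Rightarrow> 'a \<Rightarrow> 'v)) rel" where
  "CS0_rel sA mul sV =
     {((act, \<theta>), (act', \<theta>')). (act, \<theta>) \<in> CS0 sA mul sV \<and> (act', \<theta>') \<in> CS0 sA mul sV \<and>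
        act = act' \<and> cohomologous sA mul sV act \<theta> \<theta>'}"

definition HH2 ::
    "('k::field \<Rightarrow> 'a::ab_group_add \<Rightarrow> 'a) \<Rightarrow> ('a \<Rightarrow> 'a \<Rightarrow> 'a) \<Rightarrow>
     ('k \<Rightarrow> 'v::ab_group_add \<Rightarrow> 'v) \<Rightarrow> (('a \<Rightarrow> 'v \<Rightarrow> 'v) \<times> ('a \<Rightarrow> 'a \<Rightarrow> 'v)) set set" where
  "HH2 sA mul sV = CS0 sA mul sV // CS0_rel sA mul sV"

definition Z2 ::
    "('k::field \<Rightarrow> 'a::ab_group_add \<Rightarrow> 'a) \<Rightarrow> ('a \<Rightarrow> 'a \<Rightarrow> 'a) \<Rightarrow>
     ('k \<Rightarrow> 'v::ab_group_add \<Rightarrow> 'v) \<Rightarrow> ('a \<Rightarrow> 'v \<Rightarrow> 'v) \<Rightarrow> ('a \<Rightarrow> 'a \<Rightarrow> 'v) set" where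
  "Z2 sA mul sV act =
     {\<theta>. bilinear_map sA sA sV \<theta> \<and> (\<forall>a b. \<theta> a b = \<theta> b a) \<and>
        (\<forall>a b c. \<theta> a (mul b c) + \<theta> b (mul c a) + \<theta> c (mul a b) +
           act a (\<theta> b c) + act b (\<theta> c a) + act c (\<theta> a b) = 0)}"

definition Z2_rel ::
    "('k::field \<Rightarrow> 'a::ab_group_add \<Rightarrow> 'a) \<Rightarrow> ('a \<Rightarrow> 'a \<Rightarrow> 'a) \<Rightarrow>
     ('k \<Rightarrow> 'v::ab_group_add \<Rightarrow> 'v) \<Rightarrow> ('a \<Rightarrow> 'v \<Rightarrow> 'v) \<Rightarrow> ('a \<Rightarrow> 'a \<Rightarrow> 'v) rel" where
  "Z2_rel sA mul sV act =
     {(\<theta>, \<theta>'). \<theta> \<in> Z2 sA mul sV act \<and> \<theta>' \<in> Z2 sA mul sV act \<and>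
        cohomologous sA mul sV act \<theta> \<theta>'}"

definition H2 ::
    "('k::field \<Rightarrow> 'a::ab_group_add \<Rightarrow> 'a) \<Rightarrow> ('a \<Rightarrow> 'a \<Rightarrow> 'a) \<Rightarrow>
     ('k \<Rightarrow> 'v::ab_group_add \<Rightarrow> 'v) \<Rightarrow> ('a \<Rightarrow> 'v \<Rightarrow> 'v) \<Rightarrow> ('a \<Rightarrow> 'a \<Rightarrow> 'v) set set" where
  "H2 sA mul sV act = Z2 sA mul sV act // Z2_rel sA mul sV act"

lemma bilinear_map_right:
  assumes "bilinear_map s1 s2 s3 f"
  shows "f x 0 = 0" "f x (u + v) = f x u + f x v" "f x (- u) = - f x u"
proof -
  interpret Vector_Spaces.linear s2 s3 "f x"
    using assms by (simp add: bilinear_map_def)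
  show "f x 0 = 0" "f x (u + v) = f x u + f x v" "f x (- u) = - f x u"
    by (simp_all add: zero add neg)
qed

lemma cohomologous_refl:
  assumes "vector_space sA" "vector_space sV" "bilinear_map sA sV sV act"
  shows "cohomologous sA mul sV act \<theta> \<theta>"
proof -
  interpret vector_space_pair sA sV using assms by (simp add: vector_space_pair_def)
  show ?thesis unfolding cohomologous_def
    by (rule exI[of _ "\<lambda>_. 0"]) (simp add: linear_zero bilinear_map_right[OF assms(3)])
qed

lemma cohomologous_sym:
  assumes "vector_space sA" "vector_space sV" "bilinear_map sA sV sV act"
    and "cohomologous sA mul sV act \<theta> \<theta>'"
  shows "cohomologous sA mul sV act \<theta>' \<theta>"
proof -
  interpret vector_space_pair sA sV using assms by (simp add: vector_space_pair_def)
  obtain r where r: "Vector_Spaces.linear sA sV r"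
    and e: "\<And>a b. \<theta> a b = \<theta>' a b + act a (r b) + act b (r a) - r (mul a b)"
    using assms(4) unfolding cohomologous_def by blast
  show ?thesis unfolding cohomologous_def
    by (rule exI[of _ "\<lambda>a. - r a"])
      (simp add: linear_compose_neg[OF r] bilinear_map_right[OF assms(3)] e)
qed

lemma cohomologous_trans:
  assumes "vector_space sA" "vector_space sV" "bilinear_map sA sV sV act"
    and "cohomologous sA mul sV act \<theta> \<theta>'" "cohomologous sA mul sV act \<theta>' \<theta>''"
  shows "cohomologous sA mul sV act \<theta> \<theta>''"
proof -
  interpret vector_space_pair sA sV using assms by (simp add: vector_space_pair_def)
  obtain r where r: "Vector_Spaces.linear sA sV r"
    and e: "\<And>a b. \<theta> a b = \<theta>' a b + act a (r b) + act b (r a) - r (mul a b)"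
    using assms(4) unfolding cohomologous_def by blast
  obtain q where q: "Vector_Spaces.linear sA sV q"
    and f: "\<And>a b. \<theta>' a b = \<theta>'' a b + act a (q b) + act b (q a) - q (mul a b)"
    using assms(5) unfolding cohomologous_def by blast
  show ?thesis unfolding cohomologous_def
    by (rule exI[of _ "\<lambda>a. r a + q a"])
      (simp add: linear_compose_add[OF r q] bilinear_map_right[OF assms(3)] e f)
qed

lemma equiv_CS0_rel:
  assumes "vector_space sA" "vector_space sV"
  shows "equiv (CS0 sA mul sV) (CS0_rel sA mul sV)"
proof (rule equivI)
  have b: "bilinear_map sA sV sV act" if "(act, \<theta>) \<in> CS0 sA mul sV" for act \<theta>
    using that by (simp add: CS0_def)
  show "CS0_rel sA mul sV \<subseteq> CS0 sA mul sV \<times> CS0 sA mul sV"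
    by (auto simp: CS0_rel_def)
  show "refl_on (CS0 sA mul sV) (CS0_rel sA mul sV)"
    by (auto simp: refl_on_def CS0_rel_def intro: cohomologous_refl[OF assms] b)
  show "sym (CS0_rel sA mul sV)"
    by (auto simp: sym_def CS0_rel_def intro: cohomologous_sym[OF assms] b)
  show "trans (CS0_rel sA mul sV)"
    by (auto simp: trans_def CS0_rel_def intro: cohomologous_trans[OF assms] b)
qed

lemma equiv_Z2_rel:
  assumes "vector_space sA" "vector_space sV" "jj_module sA mul sV act"
  shows "equiv (Z2 sA mul sV act) (Z2_rel sA mul sV act)"
proof (rule equivI)
  have b: "bilinear_map sA sV sV act"
    using assms(3) by (simp add: jj_module_def)
  show "Z2_rel sA mul sV act \<subseteq> Z2 sA mul sV act \<times> Z2 sA mul sV act"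
    by (auto simp: Z2_rel_def)
  show "refl_on (Z2 sA mul sV act) (Z2_rel sA mul sV act)"
    by (auto simp: refl_on_def Z2_rel_def intro: cohomologous_refl[OF assms(1,2) b])
  show "sym (Z2_rel sA mul sV act)"
    by (auto simp: sym_def Z2_rel_def intro: cohomologous_sym[OF assms(1,2) b])
  show "trans (Z2_rel sA mul sV act)"
    by (auto simp: trans_def Z2_rel_def intro: cohomologous_trans[OF assms(1,2) b])
qed

end

theory Submission
  imports Defs
begin

text \<open>
  The Jacobi identity of the crossed product, evaluated on \<open>(a, 0)\<close>, \<open>(b, 0)\<close>, \<open>(0, x)\<close>, is the
  module axiom, and on \<open>(a, 0)\<close>, \<open>(b, 0)\<close>, \<open>(c, 0)\<close> it is the cocycle condition; by
  multilinearity these cases suffice. So crossed systems are pairs of a module structure and a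
  cocycle. Equivalent systems have the same action, so every class lies over a single
  action, and the bijection sends \<open>(act, C)\<close> to \<open>{act} \<times> C\<close>.
\<close>

text \<open>\<open>Vector_Spaces.linear\<close> also asserts that domain and codomain are vector
  spaces. With this assumed, bilinearity reduces to four equations, a form in which the simplifier
  can check the crossed product.\<close>

lemma bilinear_map_iff:
  assumes "vector_space s1" "vector_space s2" "vector_space s3"
  shows "bilinear_map s1 s2 s3 f \<longleftrightarrow>
     (\<forall>x u v. f x (u + v) = f x u + f x v) \<and> (\<forall>x c u. f x (s2 c u) = s3 c (f x u)) \<and>
     (\<forall>x u v. f (u + v) x = f u x + f v x) \<and> (\<forall>x c u. f (s1 c u) x = s3 c (f u x))"
  using assms by (auto simp: bilinear_map_def Vector_Spaces.linear_iff)

lemma bilinear_map_left_zero: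
  assumes "bilinear_map s1 s2 s3 f"
  shows "f 0 y = 0"
proof -
  interpret Vector_Spaces.linear s1 s3 "\<lambda>x. f x y"
    using assms by (simp add: bilinear_map_def)
  show ?thesis by (rule zero)
qed

lemma vector_space_prod_scale:
  assumes "vector_space s1" "vector_space s2"
  shows "vector_space (module_prod.scale s1 s2)"
    and "module_prod.scale s1 s2 c (x, y) = (s1 c x, s2 c y)"
proof -
  interpret vector_space_prod s1 s2
    using assms by (simp add: vector_space_prod_def vector_space_pair_def)
  show "vector_space scale" by unfold_locales
  show "scale c (x, y) = (s1 c x, s2 c y)" by (simp add: scale_def)
qed

text \<open>This fibres the crossed systems over the actions, so that both equivalence relations can
  be compared one action at a time.\<close>

lemma CS0_iff:
  fixes sA :: "'k::field \<Rightarrow> 'a::ab_group_add \<Rightarrow> 'a"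
    and sV :: "'k \<Rightarrow> 'v::ab_group_add \<Rightarrow> 'v"
  assumes "jj_algebra sA mul" and sV: "vector_space sV"
  shows "(act, \<theta>) \<in> CS0 sA mul sV \<longleftrightarrow> jj_module sA mul sV act \<and> \<theta> \<in> Z2 sA mul sV act"
proof -
  interpret A: jj_algebra sA mul by fact
  interpret V: vector_space sV by fact
  note vs = A.vector_space_axioms V.vector_space_axioms
  note sc = vector_space_prod_scale[OF vs]
  have mul_bil: "bilinear_map sA sA sA mul" by (rule A.bilinear)
  have cm: "crossed_mul mul act \<theta> (a, x) (b, y) = (mul a b, \<theta> a b + act a y + act b x)"
    for a b x y by (simp add: crossed_mul_def)
  note mz = bilinear_map_right(1)[OF mul_bil]
  have mz': "mul 0 a = 0" for a using mz A.commute by metis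
  show ?thesis
  proof
    assume "(act, \<theta>) \<in> CS0 sA mul sV"
    then have act: "bilinear_map sA sV sV act" and th: "bilinear_map sA sA sV \<theta>"
      and "jj_algebra (module_prod.scale sA sV) (crossed_mul mul act \<theta>)"
      by (auto simp: CS0_def)
    then interpret E: jj_algebra "module_prod.scale sA sV" "crossed_mul mul act \<theta>" by simp
    \<comment> \<open>The Jacobi identity is evaluated on pairs with a zero entry; these facts
      delete every term that has a zero argument.\<close>
    note z = bilinear_map_right(1)[OF act] bilinear_map_right(1)[OF th]
      bilinear_map_left_zero[OF act] bilinear_map_left_zero[OF th] mz mz'
    have "act (mul a b) x = - act a (act b x) - act b (act a x)" for a b x
      using E.jacobi[of "(a, 0)" "(b, 0)" "(0, x)"]
      by (simp add: cm z zero_prod_def) (metis add.commute add_eq_0_iff minus_add diff_conv_add_uminus)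
    moreover have sym: "\<theta> a b = \<theta> b a" for a b
      using E.commute[of "(a, 0)" "(b, 0)"] by (simp add: cm z)
    moreover have "\<theta> a (mul b c) + \<theta> b (mul c a) + \<theta> c (mul a b) +
           act a (\<theta> b c) + act b (\<theta> c a) + act c (\<theta> a b) = 0" for a b c
      using E.jacobi[of "(a, 0)" "(b, 0)" "(c, 0)"] by (simp add: cm z zero_prod_def algebra_simps)
    ultimately show "jj_module sA mul sV act \<and> \<theta> \<in> Z2 sA mul sV act"
      using act th by (auto simp: jj_module_def Z2_def)
  next
    assume "jj_module sA mul sV act \<and> \<theta> \<in> Z2 sA mul sV act"
    then have act: "bilinear_map sA sV sV act" and th: "bilinear_map sA sA sV \<theta>"
      and mod: "\<And>a b x. act (mul a b) x = - act a (act b x) - act b (act a x)"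
      and sym: "\<And>a b. \<theta> a b = \<theta> b a"
      and coc: "\<And>a b c. \<theta> a (mul b c) + \<theta> b (mul c a) + \<theta> c (mul a b) +
           act a (\<theta> b c) + act b (\<theta> c a) + act c (\<theta> a b) = 0"
      by (auto simp: jj_module_def Z2_def)
    have com: "crossed_mul mul act \<theta> p q = crossed_mul mul act \<theta> q p" for p q
      by (cases p; cases q) (simp add: cm, metis A.commute sym)
    have "jj_algebra (module_prod.scale sA sV) (crossed_mul mul act \<theta>)"
    proof (intro jj_algebra.intro jj_algebra_axioms.intro sc(1) com)
      show "bilinear_map (module_prod.scale sA sV) (module_prod.scale sA sV)
          (module_prod.scale sA sV) (crossed_mul mul act \<theta>)"
        using act th mul_bil
        unfolding bilinear_map_iff[OF sc(1) sc(1) sc(1)] bilinear_map_iff[OF vs(1,1,2)]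
          bilinear_map_iff[OF vs(1,2,2)] bilinear_map_iff[OF vs(1,1,1)]
        by (auto simp: cm sc(2) V.scale_right_distrib algebra_simps)
      fix p q r :: "'a \<times> 'v"
      obtain a x b y c z where "p = (a, x)" "q = (b, y)" "r = (c, z)"
        by (metis surj_pair)
      then show "crossed_mul mul act \<theta> p (crossed_mul mul act \<theta> q r) +
          crossed_mul mul act \<theta> q (crossed_mul mul act \<theta> r p) +
          crossed_mul mul act \<theta> r (crossed_mul mul act \<theta> p q) = 0"
        \<comment> \<open>The first component is the Jacobi identity of \<open>A\<close>. In the
          second, the terms free of \<open>x\<close>, \<open>y\<close>, \<open>z\<close> sum to zero
          by \<open>coc\<close>; those in \<open>x\<close> are
          \<open>act (mul b c) x + act b (act c x) + act c (act b x)\<close>, which is zero by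
          \<open>mod\<close>, and likewise for \<open>y\<close> and \<open>z\<close>.\<close>
        using coc[of a b c] A.jacobi[of a b c]
        by (simp add: cm zero_prod_def bilinear_map_right[OF act] mod algebra_simps)
    qed
    then show "(act, \<theta>) \<in> CS0 sA mul sV"
      using act th by (simp add: CS0_def)
  qed
qed

theorem corollary2p11:
  fixes sA :: "'k::field \<Rightarrow> 'a::ab_group_add \<Rightarrow> 'a"
    and mul :: "'a \<Rightarrow> 'a \<Rightarrow> 'a"
    and sV :: "'k \<Rightarrow> 'v::ab_group_add \<Rightarrow> 'v"
  assumes "jj_algebra sA mul"
    and "vector_space sV"
  shows "\<exists>\<Phi>. bij_betw \<Phi> (SIGMA act : {act. jj_module sA mul sV act}. H2 sA mul sV act)
                       (HH2 sA mul sV) \<and>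
             (\<forall>act \<theta>. jj_module sA mul sV act \<longrightarrow> \<theta> \<in> Z2 sA mul sV act \<longrightarrow>
                \<Phi> (act, Z2_rel sA mul sV act `` {\<theta>}) = CS0_rel sA mul sV `` {(act, \<theta>)})"
proof -
  define \<Phi> where "\<Phi> = (\<lambda>(act :: 'a \<Rightarrow> 'v \<Rightarrow> 'v, C :: ('a \<Rightarrow> 'a \<Rightarrow> 'v) set). Pair act ` C)"
  note iff = CS0_iff[OF assms]
  have sA: "vector_space sA" using assms(1) by (rule jj_algebra.axioms)
  \<comment> \<open>For a fixed module structure the two relations impose the same condition on
    cocycles. If \<theta> is not a cocycle, both sides are empty.\<close>
  have cls: "\<Phi> (act, Z2_rel sA mul sV act `` {\<theta>}) = CS0_rel sA mul sV `` {(act, \<theta>)}"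
    if "jj_module sA mul sV act" for act \<theta>
    using that by (auto simp: \<Phi>_def CS0_rel_def Z2_rel_def iff)
  \<comment> \<open>The image of an empty set under \<open>Pair act\<close> would forget
    \<open>act\<close>, so injectivity rests on classes being nonempty.\<close>
  have ne: "C \<noteq> {}" if "jj_module sA mul sV act" "C \<in> H2 sA mul sV act" for act C
    using that equiv_Z2_rel[OF sA assms(2)] in_quotient_imp_non_empty unfolding H2_def by metis
  have "inj_on \<Phi> (SIGMA act : {act. jj_module sA mul sV act}. H2 sA mul sV act)"
  proof (rule inj_onI, clarify)
    fix act C act' C'
    assume "jj_module sA mul sV act" "C \<in> H2 sA mul sV act" and e: "\<Phi> (act, C) = \<Phi> (act', C')"
    then have "C \<noteq> {}" using ne by blast
    \<comment> \<open>Any element of the common image has first component both \<open>act\<close>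
      and \<open>act'\<close>; the second components then recover \<open>C\<close>.\<close>
    with e show "act = act' \<and> C = C'" by (auto simp: \<Phi>_def)
  qed
  moreover have "\<Phi> ` (SIGMA act : {act. jj_module sA mul sV act}. H2 sA mul sV act) = HH2 sA mul sV"
  proof (intro equalityI subsetI)
    fix D assume "D \<in> \<Phi> ` (SIGMA act : {act. jj_module sA mul sV act}. H2 sA mul sV act)"
    then obtain act \<theta> where "jj_module sA mul sV act" "\<theta> \<in> Z2 sA mul sV act"
      "D = \<Phi> (act, Z2_rel sA mul sV act `` {\<theta>})"
      by (auto simp: H2_def quotient_def)
    then show "D \<in> HH2 sA mul sV"
      by (auto simp: cls HH2_def iff intro: quotientI)
  next
    fix D assume "D \<in> HH2 sA mul sV"
    \<comment> \<open>A representative of the class \<open>D\<close> is a module structure with a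
      cocycle, and the class of that cocycle is the preimage of \<open>D\<close>.\<close>
    then obtain act \<theta> where m: "jj_module sA mul sV act" "\<theta> \<in> Z2 sA mul sV act"
      and D: "D = CS0_rel sA mul sV `` {(act, \<theta>)}"
      unfolding HH2_def by (auto elim!: quotientE simp: iff)
    have "D = \<Phi> (act, Z2_rel sA mul sV act `` {\<theta>})" using cls[OF m(1)] D by simp
    moreover have "Z2_rel sA mul sV act `` {\<theta>} \<in> H2 sA mul sV act"
      unfolding H2_def using m(2) by (rule quotientI)
    ultimately show "D \<in> \<Phi> ` (SIGMA act : {act. jj_module sA mul sV act}. H2 sA mul sV act)"
      using m(1) by blast
  qed
  ultimately show ?thesis
    using cls unfolding bij_betw_def by blast
qed

end
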